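(* Let $(u_n)_{n=0}^{\infty}$ be a convex real sequence. Then there exists a continuous, almost everywhere differentiable, convex function $f:\mathbb{R}_+\to\mathbb{R}$ such that $f(n)=u_n$ for all $n\in\mathbb{N}\cup\{0\}$. Conversely, if $f:\mathbb{R}_+\to\mathbb{R}$ is convex, then the sequence $(f(n))_{n=0}^{\infty}$ is convex.
   Context: $\mathbb{N}=\{1,2,\dots\}$ and $\mathbb{R}_+=[0,\infty)$. A real sequence $(u_n)_{n=0}^{\infty}$ is convex if $2u_n\le u_{n-1}+u_{n+1}$ for all $n\in\mathbb{N}$. *)

theory Defs
  imports "HOL-Analysis.Analysis"
begin

definition convex_seq :: "(nat \<Rightarrow> real) \<Rightarrow> bool" where
  "convex_seq u \<longleftrightarrow> (\<forall>n\<ge>1. 2 * u n \<le> u (n - 1) + u (n + 1))"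

end

theory Submission
  imports Defs
begin

text \<open>The interpolating function is the broken line through the points \<open>(n, u n)\<close>. Write
  \<open>chord u k\<close> for the line through the points with abscissae \<open>k\<close> and \<open>k + 1\<close>. Consecutive
  chords cross at \<open>k + 1\<close>, and convexity of \<open>u\<close> says exactly that their slopes do not decrease; hence
  at a point of \<open>[m, m + 1]\<close> no chord lies above the \<open>m\<close>-th one
  (\<open>chord_le_interpolant\<close>). So each value of the broken line is the value of a line that lies
  below the broken line everywhere on the half-line, and the existence of such a supporting line
  at every point gives convexity (\<open>convex_on_if_supported\<close>). A convex function is continuous in the
  interior of its domain, and near \<open>0\<close> the broken line is a single chord. It is differentiable
  wherever it is locally a single chord, that is, outside the countable set of the natural
  numbers.

  The converse is midpoint convexity between \<open>n - 1\<close> and \<open>n + 1\<close>.\<close>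

definition chord :: "(nat \<Rightarrow> real) \<Rightarrow> nat \<Rightarrow> real \<Rightarrow> real" where
  "chord u k x = u k + (x - real k) * (u (Suc k) - u k)"

definition interpolant :: "(nat \<Rightarrow> real) \<Rightarrow> real \<Rightarrow> real" where
  "interpolant u x = chord u (nat \<lfloor>x\<rfloor>) x"

lemma interpolant_of_nat: "interpolant u (real n) = u n"
  by (simp add: interpolant_def chord_def)

lemma interpolant_eq_chord:
  assumes "real k \<le> x" "x < real k + 1"
  shows "interpolant u x = chord u k x"
proof -
  have "\<lfloor>x\<rfloor> = int k"
    using assms by (simp add: floor_eq_iff)
  then show ?thesis
    by (simp add: interpolant_def)
qed

lemma chord_Suc_diff:
  "chord u (Suc k) x - chord u k x
    = (x - real (Suc k)) * (u k + u (Suc (Suc k)) - 2 * u (Suc k))"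
  by (simp add: chord_def algebra_simps)

lemma convex_seq_Suc: "convex_seq u \<Longrightarrow> 0 \<le> u k + u (Suc (Suc k)) - 2 * u (Suc k)"
  unfolding convex_seq_def by (auto dest: spec[of _ "Suc k"])

text \<open>Moving from the index \<open>k\<close> to the index \<open>m\<close> of the cell that contains \<open>x\<close>, one passes only
  crossing points that lie on the appropriate side of \<open>x\<close>, so the value at \<open>x\<close> does not
  decrease at any step, from either direction.\<close>

lemma chord_le_chord:
  assumes u: "convex_seq u" and x: "real m \<le> x" "x \<le> real m + 1"
  shows "chord u k x \<le> chord u m x"
proof (cases "k \<le> m")
  case True
  then show ?thesis
  proof (induction rule: inc_induct)
    case (step n)
    have "0 \<le> chord u (Suc n) x - chord u n x"
      unfolding chord_Suc_diff using step.hyps x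
      by (intro mult_nonneg_nonneg convex_seq_Suc u) linarith
    with step.IH show ?case by simp
  qed simp
next
  case False
  then have "m \<le> k" by simp
  then show ?thesis
  proof (induction rule: dec_induct)
    case (step n)
    have "chord u (Suc n) x - chord u n x \<le> 0"
      unfolding chord_Suc_diff using step.hyps x
      by (intro mult_nonpos_nonneg convex_seq_Suc u) linarith
    with step.IH show ?case by simp
  qed simp
qed

lemma chord_le_interpolant:
  assumes "convex_seq u" "0 \<le> x"
  shows "chord u k x \<le> interpolant u x"
  unfolding interpolant_def
  by (rule chord_le_chord) (use assms in linarith)+

text \<open>A supporting line at an intermediate point \<open>z\<close> is at most \<open>f\<close> at the two end points, and at
  \<open>z\<close> it is the weighted mean of its values there.\<close>

lemma convex_on_if_supported:
  fixes f :: "'a::real_inner \<Rightarrow> real"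
  assumes S: "convex S"
    and supp: "\<And>z. z \<in> S \<Longrightarrow> \<exists>c. \<forall>x\<in>S. f z + c \<bullet> (x - z) \<le> f x"
  shows "convex_on S f"
proof (rule convex_onI)
  fix t x y
  assume t: "0 < t" "t < (1::real)" and xy: "x \<in> S" "y \<in> S"
  define z where "z = (1 - t) *\<^sub>R x + t *\<^sub>R y"
  have "z \<in> S"
    unfolding z_def using S xy t by (simp add: convex_def)
  from supp[OF this] obtain c where c: "\<forall>x\<in>S. f z + c \<bullet> (x - z) \<le> f x" ..
  have "(1 - t) * (f z + c \<bullet> (x - z)) \<le> (1 - t) * f x" "t * (f z + c \<bullet> (y - z)) \<le> t * f y"
    using c xy t by (simp_all add: mult_left_mono)
  moreover have "(1 - t) * (f z + c \<bullet> (x - z)) + t * (f z + c \<bullet> (y - z)) = f z"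
  proof -
    have "(1 - t) * (f z + c \<bullet> (x - z)) + t * (f z + c \<bullet> (y - z))
        = f z + c \<bullet> ((1 - t) *\<^sub>R (x - z) + t *\<^sub>R (y - z))"
      by (simp only: inner_add_right inner_scaleR_right) (simp add: algebra_simps)
    also have "(1 - t) *\<^sub>R (x - z) + t *\<^sub>R (y - z) = 0"
      by (simp add: z_def algebra_simps)
    finally show ?thesis by simp
  qed
  ultimately show "f ((1 - t) *\<^sub>R x + t *\<^sub>R y) \<le> (1 - t) * f x + t * f y"
    unfolding z_def by linarith
qed (rule S)

lemma convex_on_interpolant:
  assumes u: "convex_seq u"
  shows "convex_on {0..} (interpolant u)"
proof (rule convex_on_if_supported)
  fix z :: real
  define k where "k = nat \<lfloor>z\<rfloor>"
  have "interpolant u z + (u (Suc k) - u k) \<bullet> (x - z) = chord u k x" for x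
    by (simp add: interpolant_def chord_def k_def algebra_simps)
  then show "\<exists>c. \<forall>x\<in>{0..}. interpolant u z + c \<bullet> (x - z) \<le> interpolant u x"
    using chord_le_interpolant[OF u] by (intro exI[of _ "u (Suc k) - u k"]) simp
qed simp

lemma continuous_on_interpolant:
  assumes u: "convex_seq u"
  shows "continuous_on {0..} (interpolant u)"
  unfolding continuous_on_eq_continuous_within
proof
  fix x :: real
  assume "x \<in> {0..}"
  then consider "x = 0" | "0 < x" by fastforce
  then show "continuous (at x within {0..}) (interpolant u)"
  proof cases
    case 1
    have "continuous (at x within {0..}) (chord u 0)"
      unfolding chord_def by (intro continuous_intros)
    then show ?thesis
      by (rule continuous_transform_within[of _ _ _ 1])
        (use 1 in \<open>auto simp: dist_real_def interpolant_eq_chord[of 0]\<close>)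
  next
    case 2
    have "convex_on {0<..} (interpolant u)"
      by (rule convex_on_subset[OF convex_on_interpolant[OF u]]) auto
    then have "continuous_on {0<..} (interpolant u)"
      by (intro convex_on_continuous) auto
    then have "isCont (interpolant u) x"
      using 2 by (simp add: continuous_on_eq_continuous_at)
    then show ?thesis
      by (rule continuous_at_imp_continuous_at_within)
  qed
qed

lemma interpolant_differentiable:
  assumes "0 \<le> x" "x \<notin> range real"
  shows "interpolant u differentiable (at x within S)"
proof -
  define k where "k = nat \<lfloor>x\<rfloor>"
  have "x \<noteq> real k"
    using assms(2) by blast
  moreover have "real k \<le> x" "x < real k + 1"
    unfolding k_def using assms(1) by linarith+
  ultimately have x: "x \<in> {real k<..<real k + 1}" by simp
  have "chord u k differentiable (at x)"
    unfolding chord_def by (intro derivative_intros)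
  then obtain D where "(chord u k has_derivative D) (at x)"
    unfolding differentiable_def by blast
  then have "(interpolant u has_derivative D) (at x)"
    by (rule has_derivative_transform_within_open[of _ _ _ _ "{real k<..<real k + 1}"])
      (use x in \<open>auto simp: interpolant_eq_chord[of k]\<close>)
  then have "interpolant u differentiable (at x)"
    unfolding differentiable_def by blast
  then show ?thesis
    by (rule differentiable_at_withinI)
qed

lemma AE_interpolant_differentiable:
  "AE x in lebesgue_on {0..}. interpolant u differentiable (at x within {0..})"
proof -
  have "AE x in lborel. x \<notin> range real"
    by (intro AE_not_in countable_imp_null_set_lborel) simp
  then have "AE x in lebesgue. x \<notin> range real"
    by (rule AE_completion)
  then have "AE x in lebesgue. x \<in> {0..} \<longrightarrow> interpolant u differentiable (at x within {0..})"
    by eventually_elim (simp add: interpolant_differentiable)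
  then show ?thesis
    by (simp add: AE_restrict_space_iff)
qed

lemma convex_seq_of_convex_on:
  assumes f: "convex_on {0..} f"
  shows "convex_seq (\<lambda>n. f (real n))"
  unfolding convex_seq_def
proof (intro allI impI)
  fix n :: nat
  assume n: "1 \<le> n"
  have "f ((1 - 1/2) *\<^sub>R real (n - 1) + (1/2) *\<^sub>R real (n + 1))
      \<le> (1 - 1/2) * f (real (n - 1)) + (1/2) * f (real (n + 1))"
    by (rule convex_onD[OF f]) auto
  moreover have "(1 - 1/2) *\<^sub>R real (n - 1) + (1/2) *\<^sub>R real (n + 1) = real n"
    using n by (simp add: of_nat_diff field_simps)
  ultimately show "2 * f (real n) \<le> f (real (n - 1)) + f (real (n + 1))"
    by simp
qed

theorem theorem1p8:
  shows "(\<forall>u :: nat \<Rightarrow> real. convex_seq u \<longrightarrow>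
            (\<exists>f :: real \<Rightarrow> real.
               continuous_on {0..} f \<and>
               (AE x in lebesgue_on {0..}. f differentiable (at x within {0..})) \<and>
               convex_on {0..} f \<and>
               (\<forall>n :: nat. f (real n) = u n))) \<and>
         (\<forall>f :: real \<Rightarrow> real. convex_on {0..} f \<longrightarrow> convex_seq (\<lambda>n. f (real n)))"
  using continuous_on_interpolant AE_interpolant_differentiable convex_on_interpolant
    interpolant_of_nat convex_seq_of_convex_on
  by blast

end
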